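(* Suppose that $k$ is a power of $2$, or $k$ is odd with $k\le2\phi(k)$ (for example $k=q^n$ for some odd prime $q$), or $k=2\ell$ for an odd number $\ell$ with $\ell\le2\phi(\ell)$ (for example $\ell=q^n$ for some odd prime $q$). Then $C_k(\mathbf C)\cap\mathbf T^{d+1}\ne\emptyset$, where $d=\phi(k)$.
   Context: $\phi$ is the Euler totient function and $\mathbf T$ is the complex unit circle. Let $\zeta_k$ be a primitive $k$-th root of unity. Every $k$-th root of unity is uniquely an integer linear combination of $1,\zeta_k,\dots,\zeta_k^{d-1}$; let $A_k\subset\mathbf Z^d$ be the set of the $k$ coefficient vectors, and $F_k(\mathbf x):=\sum_{\mathbf a\in A_k}\mathbf x^{\mathbf a}$ with $\mathbf x=(x_1,\dots,x_d)$. The cyclovariety $C_k$ is the hypersurface $x_0+F_k(\mathbf x)=0$ in $\mathbf G_m^{d+1}$. *)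

theory Defs
  imports "HOL-Analysis.Analysis" "HOL-Number_Theory.Number_Theory"
begin

definition primitive_root_of_unity :: "nat \<Rightarrow> complex \<Rightarrow> bool" where
  "primitive_root_of_unity k z \<longleftrightarrow> k > 0 \<and> z ^ k = 1 \<and> (\<forall>j. 0 < j \<and> j < k \<longrightarrow> z ^ j \<noteq> 1)"

text \<open>
  The dimension \<^term>\<open>totient k\<close> varies with \<^term>\<open>k\<close>, so tuples are extensional functions on an
  index set of naturals. Exponent vectors are indexed by \<open>1, \<dots>, d\<close>, to match the coordinates
  \<open>x\<^sub>1, \<dots>, x\<^sub>d\<close>; hence entry \<open>i\<close> is the coefficient of \<open>z ^ (i - 1)\<close>.
  For a primitive root \<open>z\<close> the powers \<open>1, z, \<dots>, z ^ (d - 1)\<close> form an integral basis, so each of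
  the \<open>k\<close> roots of unity contributes exactly one exponent vector; in particular
  \<open>cyclo_exponents k z\<close> is finite and the sum in \<open>cyclo_poly\<close> is a genuine finite sum.
\<close>

definition cyclo_exponents :: "nat \<Rightarrow> complex \<Rightarrow> (nat \<Rightarrow> int) set" where
  "cyclo_exponents k z =
     {a \<in> {1..totient k} \<rightarrow>\<^sub>E UNIV. (\<Sum>i=1..totient k. of_int (a i) * z ^ (i - 1)) ^ k = 1}"

definition cyclo_poly :: "nat \<Rightarrow> complex \<Rightarrow> (nat \<Rightarrow> complex) \<Rightarrow> complex" where
  "cyclo_poly k z x = (\<Sum>a\<in>cyclo_exponents k z. \<Prod>i=1..totient k. x i powi a i)"

definition cyclovariety :: "nat \<Rightarrow> complex \<Rightarrow> (nat \<Rightarrow> complex) set" where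
  "cyclovariety k z = {x \<in> {0..totient k} \<rightarrow>\<^sub>E (UNIV - {0}). x 0 + cyclo_poly k z x = 0}"

definition unit_torus :: "nat \<Rightarrow> (nat \<Rightarrow> complex) set" where
  "unit_torus d = {0..d} \<rightarrow>\<^sub>E sphere 0 1"

end

theory Submission
  imports Defs
begin

text \<open>
Write \<open>d = totient k\<close>. The coordinate \<open>x\<^sub>0\<close> enters the equation of the cyclovariety linearly, so a torus
point on it is the same as a torus point \<open>x\<close> in the other \<open>d\<close> coordinates at which
\<^const>\<open>cyclo_poly\<close> has modulus 1.

A torus point \<open>x\<close> is a character \<open>\<chi>\<close> of \<open>\<int>\<^sup>d\<close>. As \<open>1, \<zeta>, \<dots>, \<zeta>\<^sup>d\<^sup>-\<^sup>1\<close> is a basis of \<open>\<int>[\<zeta>]\<close>, it is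
a character of \<open>\<int>[\<zeta>]\<close>, and the polynomial takes at \<open>x\<close> the value \<open>\<Sum>\<^sub>w \<chi>(w)\<close>, summed over the \<open>k\<close>-th roots
of unity \<open>w\<close> (\<open>cyclo_poly_at_character\<close>). Take \<open>\<chi>\<close> in a one-parameter family \<open>w \<mapsto> exp(i t \<nu>(w))\<close> with \<open>\<nu>\<close> a
real-linear form on the complex numbers, and choose \<open>\<nu>\<close> so that its values on the roots of unity are
permuted by negation: any linear form if \<open>k\<close> is even, the imaginary part if \<open>k\<close> is odd. Then the sum
is the real function \<open>F(t) = \<Sum>\<^sub>w cos(t \<nu>(w))\<close>, with \<open>F(0) = k \<ge> 1\<close>. If moreover \<open>\<nu>(w) \<noteq> 0\<close> for \<open>w \<noteq> 1\<close>, the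
cosines belonging to \<open>w \<noteq> 1\<close> have mean value zero (\<open>sum_cos_nonpos_somewhere\<close>), so \<open>F(t) \<le> 1\<close> for some
\<open>t\<close>. By the intermediate value theorem \<open>F\<close> takes the value 1 (\<open>character_sum_eq_1\<close>).

The arithmetic input is that the powers of \<open>\<zeta>\<close> below \<open>d\<close> form a basis of \<open>\<int>[\<zeta>]\<close>
(\<open>bij_betw_cyclo_exponents\<close>), that is, that the minimal polynomial of \<open>\<zeta>\<close> is monic with integer
coefficients and has degree \<open>totient k\<close> (\<open>degree_minimal_polynomial\<close>). This is the irreducibility of the cyclotomic
polynomials, obtained by Landau's argument: for each large prime \<open>p\<close>, the value at \<open>\<zeta>\<^sup>p\<close> of the minimal
polynomial is divisible by \<open>p\<close> but comes from a finite set independent of \<open>p\<close>, so it is zero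
(\<open>eventually_prime_power_preserves_zeros\<close>); products of large primes represent all residues coprime to \<open>k\<close>.
\<close>

(* These constants share their names with the polynomial operations used below. *)
hide_const (open) Module.smult UnivPoly.coeff UnivPoly.monom

section \<open>Evaluating integer polynomials at complex numbers\<close>

definition int_eval :: "int poly \<Rightarrow> complex \<Rightarrow> complex" where
  "int_eval g z = poly (map_poly of_int g) z"

lemma int_eval_0 [simp]: "int_eval 0 z = 0"
  by (simp add: int_eval_def)

lemma int_eval_1 [simp]: "int_eval 1 z = 1"
  by (simp add: int_eval_def map_poly_1)

lemma int_eval_pCons [simp]: "int_eval (pCons a g) z = of_int a + z * int_eval g z"
  by (simp add: int_eval_def map_poly_pCons)

lemma int_eval_smult [simp]: "int_eval (smult c g) z = of_int c * int_eval g z"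
  by (induction g) (simp_all add: algebra_simps)

lemma int_eval_add [simp]: "int_eval (g + h) z = int_eval g z + int_eval h z"
  by (induction g h rule: poly_induct2) (simp_all add: algebra_simps)

lemma int_eval_diff [simp]: "int_eval (g - h) z = int_eval g z - int_eval h z"
  using int_eval_add[of "g - h" h z] by simp

lemma int_eval_mult [simp]: "int_eval (g * h) z = int_eval g z * int_eval h z"
  by (induction g) (simp_all add: algebra_simps)

lemma int_eval_power [simp]: "int_eval (g ^ n) z = int_eval g z ^ n"
  by (induction n) simp_all

lemma int_eval_monom [simp]: "int_eval (monom c n) z = of_int c * z ^ n"
  by (induction n) (simp_all add: monom_0 monom_Suc)

lemma int_eval_sum [simp]: "int_eval (\<Sum>i\<in>I. g i) z = (\<Sum>i\<in>I. int_eval (g i) z)"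
  by (induction I rule: infinite_finite_induct) simp_all

lemma int_eval_of_nat [simp]: "int_eval (of_nat n) z = of_nat n"
  by (simp add: of_nat_poly)

lemma int_eval_pcompose_monom: "int_eval (pcompose g (monom 1 j)) z = int_eval g (z ^ j)"
  by (induction g) (simp_all add: pcompose_pCons)

lemma int_eval_altdef:
  assumes "degree g \<le> n"
  shows "int_eval g z = (\<Sum>i\<le>n. of_int (coeff g i) * z ^ i)"
proof -
  have "int_eval (\<Sum>i\<le>n. monom (coeff g i) i) z = (\<Sum>i\<le>n. of_int (coeff g i) * z ^ i)"
    by simp
  then show ?thesis
    using poly_as_sum_of_monoms'[OF assms] by simp
qed

section \<open>Minimal polynomials of roots of unity over the integers\<close>

lemma degree_monom_minus_1:
  assumes "k > 0"
  shows "degree (monom 1 k - 1 :: int poly) = k"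
  using degree_add_eq_left[of "-1" "monom 1 k :: int poly"] assms by (simp add: degree_monom_eq)

text \<open>
A non-zero integer polynomial of least degree vanishing at \<open>z\<close>, made primitive, divides every integer
polynomial \<open>h\<close> vanishing at \<open>z\<close>: pseudo-division shows that it divides some \<open>c h\<close>, and comparing
contents (Gauss) removes \<open>c\<close>. It divides in particular the monic \<open>X\<^sup>k - 1\<close>, so its leading
coefficient is a unit. Working over the integers throughout gives at once that the powers of \<open>z\<close>
below the degree span \<open>\<int>[z]\<close> and are linearly independent.
\<close>

lemma minimal_int_polynomial:
  fixes z :: complex
  assumes "k > 0" "z ^ k = 1"
  obtains f where "lead_coeff f = 1" "\<And>g. int_eval g z = 0 \<longleftrightarrow> f dvd g"
proof -
  define u :: "int poly" where "u = monom 1 k - 1"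
  have lcu: "lead_coeff u = 1"
    using assms(1) by (simp add: u_def degree_monom_minus_1)
  have u: "u \<noteq> 0" "int_eval u z = 0"
    using lcu assms by (auto simp: u_def)
  define g where "g = arg_min degree (\<lambda>g. g \<noteq> 0 \<and> int_eval g z = 0)"
  have g: "g \<noteq> 0" "int_eval g z = 0"
    using arg_min_natI[of "\<lambda>g. g \<noteq> 0 \<and> int_eval g z = 0" u degree] u unfolding g_def by auto
  have min: "h = 0" if "int_eval h z = 0" "degree h < degree g" for h
    using that arg_min_nat_le[of "\<lambda>g. g \<noteq> 0 \<and> int_eval g z = 0" h degree] unfolding g_def by fastforce
  define f0 where "f0 = primitive_part g"
  have f0: "f0 \<noteq> 0" "content f0 = 1" "degree f0 = degree g"
    using g by (auto simp: f0_def)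
  have f0z: "int_eval f0 z = 0"
  proof -
    have "int_eval (smult (content g) f0) z = 0"
      using g by (simp add: f0_def del: int_eval_smult)
    then show ?thesis using g(1) by simp
  qed
  have dvd: "f0 dvd h" if h: "int_eval h z = 0" for h
  proof -
    obtain c q where c: "c \<noteq> 0" and eq: "smult c h = f0 * q + pseudo_mod h f0"
      using pseudo_mod(1)[OF f0(1)] by blast
    have "int_eval (pseudo_mod h f0) z = int_eval (smult c h - f0 * q) z"
      unfolding eq by simp
    also have "\<dots> = 0"
      using f0z h by simp
    finally have "pseudo_mod h f0 = 0"
      using min pseudo_mod(2)[OF f0(1), of h] f0(3) by auto
    with eq have eq: "smult c h = f0 * q" by simp
    \<comment> \<open>\<open>f0\<close> has content 1, so \<open>c\<close> divides the content of \<open>q\<close> and can be cancelled.\<close>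
    then have "content q = normalize c * content h"
      using content_smult[of c h] by (simp add: content_mult f0)
    moreover have "c dvd normalize c * content h"
      by (rule dvd_mult2) simp
    ultimately have "[:c:] dvd q"
      by (simp only: const_poly_dvd_iff_dvd_content)
    then obtain q' where q': "q = smult c q'" by auto
    have "smult c (h - f0 * q') = 0"
      using eq by (simp add: q' smult_diff_right)
    with c have "h = f0 * q'" by simp
    then show ?thesis by simp
  qed
  define f where "f = smult (lead_coeff f0) f0"
  have "lead_coeff f0 dvd 1"
    using dvd[OF u(2)] lcu by (metis dvd_def lead_coeff_mult)
  then have unit: "lead_coeff f0 * lead_coeff f0 = 1"
    by (metis abs_mult_self_eq mult_1 zdvd1_eq)
  show thesis
  proof (rule that)
    show "lead_coeff f = 1" using unit f0(1) by (simp add: f_def)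
  next
    fix h
    have "f dvd h" if "f0 dvd h"
    proof -
      have "f0 = smult (lead_coeff f0) f" using unit by (simp add: f_def)
      then have "f dvd f0" by (metis dvd_refl dvd_smult)
      then show ?thesis using that by (rule dvd_trans)
    qed
    moreover have "int_eval f z = 0" using f0z by (simp add: f_def)
    ultimately show "int_eval h z = 0 \<longleftrightarrow> f dvd h"
      using dvd by auto
  qed
qed

lemma monic_division:
  fixes f g :: "int poly"
  assumes "lead_coeff f = 1"
  obtains q r where "g = f * q + r" "r = 0 \<or> degree r < degree f"
proof -
  have "f \<noteq> 0" using assms by auto
  then show thesis
    using that pseudo_divmod[of f g] assms by (metis power_one prod.exhaust smult_1_left)
qed

section \<open>Irreducibility of the cyclotomic polynomials\<close>

lemma prime_dvd_power_add:
  fixes u v :: "'a :: comm_ring_1"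
  assumes "prime p"
  shows "of_nat p dvd (u + v) ^ p - u ^ p - v ^ p"
proof -
  have p: "p > 0" using assms prime_gt_0_nat by blast
  have "(u + v) ^ p = (\<Sum>i\<le>p. of_nat (p choose i) * u ^ i * v ^ (p - i))"
    by (rule binomial_ring)
  also have "{..p} = insert 0 (insert p {0<..<p})" using p by auto
  also have "(\<Sum>i\<in>\<dots>. of_nat (p choose i) * u ^ i * v ^ (p - i))
      = v ^ p + (u ^ p + (\<Sum>i\<in>{0<..<p}. of_nat (p choose i) * u ^ i * v ^ (p - i)))"
    using p by simp
  finally have "(u + v) ^ p - u ^ p - v ^ p = (\<Sum>i\<in>{0<..<p}. of_nat (p choose i) * u ^ i * v ^ (p - i))"
    by simp
  also have "of_nat p dvd \<dots>"
  proof (rule dvd_sum)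
    fix i assume "i \<in> {0<..<p}"
    then have "p dvd p choose i"
      using assms by (intro dvd_choose_prime) auto
    then have "(of_nat p :: 'a) dvd of_nat (p choose i)"
      by (auto simp: dvd_def)
    then show "of_nat p dvd of_nat (p choose i) * u ^ i * v ^ (p - i)"
      by simp
  qed
  finally show ?thesis .
qed

lemma int_fermat_little:
  fixes a :: int
  assumes "prime p"
  shows "int p dvd a ^ p - a"
proof -
  have p: "p > 0" using assms prime_gt_0_nat by blast
  have nat: "int p dvd int n ^ p - int n" for n
  proof (induction n)
    case 0
    then show ?case using p by (simp add: power_0_left)
  next
    case (Suc n)
    have "int p dvd ((int n + 1) ^ p - int n ^ p - 1 ^ p) + (int n ^ p - int n)"
      by (rule dvd_add[OF _ Suc]) (use prime_dvd_power_add[OF assms, of "int n" 1] in simp)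
    then show ?case by (simp add: algebra_simps)
  qed
  define b where "b = a mod int p"
  have "int p dvd b ^ p - b"
    using nat[of "nat b"] p by (simp add: b_def)
  moreover have "[b ^ p - b = a ^ p - a] (mod int p)"
    unfolding b_def by (intro cong_diff cong_pow) auto
  ultimately show ?thesis using cong_dvd_iff by blast
qed

text \<open>
The Frobenius congruence \<open>g(X\<^sup>p) \<equiv> g(X)\<^sup>p\<close> modulo \<open>p\<close>, by additivity of the \<open>p\<close>-th power modulo \<open>p\<close>
and Fermat's little theorem for the coefficients.
\<close>

lemma prime_dvd_pcompose_monom:
  fixes g :: "int poly"
  assumes "prime p"
  shows "of_nat p dvd pcompose g (monom 1 p) - g ^ p"
proof (induction g)
  case 0
  then show ?case using prime_gt_0_nat[OF assms] by (simp add: power_0_left)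
next
  case (pCons a g)
  let ?X = "[:0, 1:] :: int poly"
  have X: "monom 1 p = ?X ^ p" by (simp add: monom_altdef)
  have eq: "pCons a g = [:a:] + ?X * g" by simp
  have gen: "u + Y ^ p * G - (u + Y * g) ^ p =
      - ((u + Y * g) ^ p - u ^ p - (Y * g) ^ p) - (u ^ p - u) + Y ^ p * (G - g ^ p)"
    for u Y G g :: "int poly"
    by (simp add: algebra_simps)
  have "pcompose (pCons a g) (monom 1 p) - pCons a g ^ p
      = - ((([:a:] + ?X * g) ^ p - [:a:] ^ p - (?X * g) ^ p)) - ([:a:] ^ p - [:a:])
        + ?X ^ p * (pcompose g (monom 1 p) - g ^ p)"
    unfolding pcompose_pCons X unfolding eq by (rule gen)
  moreover have "of_nat p dvd ([:a:] + ?X * g) ^ p - [:a:] ^ p - (?X * g) ^ p"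
    by (rule prime_dvd_power_add[OF assms])
  moreover have "of_nat p dvd [:a:] ^ p - [:a:]"
    using int_fermat_little[OF assms, of a] by (simp add: of_nat_poly poly_const_pow)
  ultimately show ?case
    using pCons.IH by (metis dvd_add dvd_diff dvd_minus_iff dvd_mult)
qed

lemma root_of_unity_power_mod:
  fixes z :: complex
  assumes "z ^ k = 1"
  shows "z ^ (n mod k) = z ^ n"
proof -
  have "z ^ n = z ^ (k * (n div k) + n mod k)" by simp
  also have "\<dots> = z ^ (n mod k)"
    unfolding power_add power_mult assms by simp
  finally show ?thesis by simp
qed

text \<open>
Coefficients with respect to the basis \<open>1, z, z\<^sup>2, \<dots>\<close> of \<open>\<int>[z]\<close> are unique, so an element that is
\<open>n\<close> times another one has all its coefficients divisible by \<open>n\<close>. Once \<open>n\<close> exceeds them in absolute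
value, they vanish.
\<close>

lemma eventually_multiple_imp_zero:
  fixes z :: complex
  assumes "k > 0" "z ^ k = 1"
  shows "\<forall>\<^sub>F n in at_top. \<forall>h. int_eval g z = of_nat n * int_eval h z \<longrightarrow> int_eval g z = 0"
proof -
  obtain f where f: "lead_coeff f = 1" "\<And>g. int_eval g z = 0 \<longleftrightarrow> f dvd g"
    using minimal_int_polynomial[OF assms] by blast
  have fz: "int_eval f z = 0" using f(2) by simp
  obtain q s where s: "g = f * q + s" "s = 0 \<or> degree s < degree f"
    using monic_division[OF f(1)] by blast
  have gs: "int_eval g z = int_eval s z" by (simp add: s fz)
  show ?thesis
  proof (cases "s = 0")
    case True
    then show ?thesis by (simp add: gs)
  next
    case False
    have "int_eval g z = 0"
      if n: "n > nat \<bar>lead_coeff s\<bar>" and h: "int_eval g z = of_nat n * int_eval h z" for n h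
    proof -
      obtain q' r where r: "h = f * q' + r" "r = 0 \<or> degree r < degree f"
        using monic_division[OF f(1)] by blast
      have "int_eval (s - smult (int n) r) z = 0"
        using h gs by (simp add: r fz)
      then have "f dvd s - smult (int n) r" by (simp only: f(2))
      moreover have "degree (s - smult (int n) r) < degree f"
        using s(2) r(2) False by (intro degree_diff_less) (auto simp: le_less_trans[OF degree_smult_le])
      ultimately have "s = smult (int n) r"
        using dvd_imp_degree_le[of f "s - smult (int n) r"] by fastforce
      then have "int n dvd lead_coeff s" by simp
      then have "int n \<le> \<bar>lead_coeff s\<bar>"
        using False by (intro zdvd_imp_le) auto
      then show ?thesis using n by linarith
    qed
    then show ?thesis
      unfolding eventually_at_top_dense by blast
  qed
qed

text \<open>
Landau's argument. Let \<open>f\<close> be the minimal polynomial of \<open>z\<close>. The Frobenius congruence and \<open>f(z) = 0\<close>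
show that \<open>f(z\<^sup>p)\<close> lies in \<open>p \<int>[z]\<close>. But \<open>f(z\<^sup>p)\<close> depends only on \<open>p\<close> modulo \<open>k\<close>, so it takes finitely
many values as \<open>p\<close> varies, and for large \<open>p\<close> divisibility by \<open>p\<close> forces it to be zero.
\<close>

lemma eventually_prime_power_preserves_zeros:
  fixes z :: complex
  assumes "k > 0" "z ^ k = 1"
  shows "\<forall>\<^sub>F p in at_top. prime p \<longrightarrow> (\<forall>g. int_eval g z = 0 \<longrightarrow> int_eval g (z ^ p) = 0)"
proof -
  obtain f where f: "lead_coeff f = 1" "\<And>g. int_eval g z = 0 \<longleftrightarrow> f dvd g"
    using minimal_int_polynomial[OF assms] by blast
  have fz: "int_eval f z = 0" using f(2) by simp
  have "\<forall>\<^sub>F p in at_top. \<forall>j\<in>{..<k}. \<forall>h. int_eval (pcompose f (monom 1 j)) z = of_nat p * int_eval h z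
          \<longrightarrow> int_eval (pcompose f (monom 1 j)) z = 0"
    using assms by (intro eventually_ball_finite ballI eventually_multiple_imp_zero) auto
  then show ?thesis
  proof eventually_elim
    case (elim p)
    show ?case
    proof (intro impI allI)
      fix g assume p: "prime p" and g: "int_eval g z = 0"
      have mod: "z ^ (p mod k) = z ^ p"
        using assms(2) by (rule root_of_unity_power_mod)
      obtain h where "pcompose f (monom 1 p) - f ^ p = of_nat p * h"
        using prime_dvd_pcompose_monom[OF p, of f] by (elim dvdE)
      then have "int_eval (pcompose f (monom 1 p) - f ^ p) z = of_nat p * int_eval h z"
        by simp
      then have "int_eval (pcompose f (monom 1 (p mod k))) z = of_nat p * int_eval h z"
        using prime_gt_0_nat[OF p] by (simp add: int_eval_pcompose_monom mod fz power_0_left)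
      then have "int_eval (pcompose f (monom 1 (p mod k))) z = 0"
        using elim assms(1) by (metis lessThan_iff mod_less_divisor)
      then have "int_eval f (z ^ p) = 0"
        by (simp add: int_eval_pcompose_monom mod)
      moreover obtain q where "g = f * q"
        using g f(2) by (auto elim: dvdE)
      ultimately show "int_eval g (z ^ p) = 0" by simp
    qed
  qed
qed

text \<open>
Add to \<open>j\<close> the product of \<open>k\<close> and the small primes that do not divide \<open>j\<close>: a small prime then
divides exactly one of the two summands.
\<close>

lemma coprime_representative_large_primes:
  fixes j k B :: nat
  assumes "coprime j k"
  obtains m where "[m = j] (mod k)" "\<And>p. prime p \<Longrightarrow> p dvd m \<Longrightarrow> p > B"
proof
  define P where "P = {p. prime p \<and> p \<le> B \<and> \<not> p dvd j}"
  have fin: "finite P" by (rule finite_subset[of _ "{..B}"]) (auto simp: P_def)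
  show "[j + k * \<Prod>P = j] (mod k)" by (simp add: cong_def)
  fix p assume p: "prime p" "p dvd j + k * \<Prod>P"
  show "p > B"
  proof (rule ccontr)
    assume "\<not> p > B"
    then have le: "p \<le> B" by simp
    show False
    proof (cases "p dvd j")
      case True
      then have "p dvd k * \<Prod>P" using p(2) by (simp add: dvd_add_right_iff)
      then consider "p dvd k" | "p dvd \<Prod>P" using p(1) prime_dvd_mult_iff by blast
      then show False
      proof cases
        case 1
        then show False using coprime_common_divisor[OF assms True] p(1) by auto
      next
        case 2
        then obtain q where "q \<in> P" "p dvd q" using p(1) fin prime_dvd_prod_iff[of P p "\<lambda>x. x"] by auto
        then show False using p(1) True by (auto simp: P_def dest: primes_dvd_imp_eq)
      qed
    next
      case False
      then have "p \<in> P" using p(1) le by (simp add: P_def)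
      then have "p dvd k * \<Prod>P" using fin dvd_prodI[of P p "\<lambda>x. x"] by auto
      then show False using p(2) False by (simp add: dvd_add_left_iff)
    qed
  qed
qed

text \<open>
All conjugates of \<open>z\<close> are reached by multiplying exponents one large prime at a time. The preceding
result has to be applied to intermediate powers of \<open>z\<close> as well, so the bound on the primes is taken
uniformly over the finitely many \<open>k\<close>-th roots of unity.
\<close>

lemma coprime_power_preserves_zeros:
  fixes z :: complex
  assumes k: "k > 0" and z: "z ^ k = 1" and j: "coprime j k" and g: "int_eval g z = 0"
  shows "int_eval g (z ^ j) = 0"
proof -
  let ?R = "{w :: complex. w ^ k = 1}"
  have "finite ?R" using k by (intro finite_roots_unity) simp
  then have "\<forall>\<^sub>F p in at_top. \<forall>w\<in>?R. prime p \<longrightarrow> (\<forall>g. int_eval g w = 0 \<longrightarrow> int_eval g (w ^ p) = 0)"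
    using k by (intro eventually_ball_finite ballI eventually_prime_power_preserves_zeros) auto
  then obtain B where B: "\<And>p w g. p \<ge> B \<Longrightarrow> w ^ k = 1 \<Longrightarrow> prime p \<Longrightarrow> int_eval g w = 0 \<Longrightarrow> int_eval g (w ^ p) = 0"
    unfolding eventually_at_top_linorder by blast
  have step: "(\<And>p. prime p \<Longrightarrow> p dvd m \<Longrightarrow> p > B) \<Longrightarrow> m > 0 \<Longrightarrow> w ^ k = 1 \<Longrightarrow> int_eval g w = 0
      \<Longrightarrow> int_eval g (w ^ m) = 0" for m w g
  proof (induction m arbitrary: w g rule: prime_divisors_induct)
    case zero
    then show ?case by simp
  next
    case (unit m)
    then show ?case by simp
  next
    case (factor p m)
    have p: "p > B" using factor.prems(1) factor.hyps by simp
    have "int_eval g (w ^ p) = 0"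
      using B[of p w g] p factor by simp
    moreover have "(w ^ p) ^ k = 1"
      using factor.prems(3) by (metis mult.commute power_mult power_one)
    ultimately have "int_eval g ((w ^ p) ^ m) = 0"
      using factor by (intro factor.IH) auto
    then show ?case by (simp add: power_mult)
  qed
  \<comment> \<open>The bound 2 excludes \<open>m = 0\<close>, which every prime divides.\<close>
  obtain m where m: "[m = j] (mod k)" "\<And>p. prime p \<Longrightarrow> p dvd m \<Longrightarrow> p > max B 2"
    using coprime_representative_large_primes[OF j] by blast
  have "m > 0"
    using m(2)[of 2] by (intro gr0I) auto
  then have "int_eval g (z ^ m) = 0" using step[of m z g] m(2) z g by auto
  moreover have "z ^ m = z ^ j"
    using m(1) root_of_unity_power_mod[OF z] unfolding cong_def by metis
  ultimately show ?thesis by simp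
qed

section \<open>The integral power basis and the exponent vectors\<close>

lemma primitive_root_power_inj:
  assumes "primitive_root_of_unity k z"
  shows "inj_on (\<lambda>j. z ^ j) {1..k}"
proof -
  have k: "k > 0" "z ^ k = 1" and min: "\<And>j. 0 < j \<Longrightarrow> j < k \<Longrightarrow> z ^ j \<noteq> 1"
    using assms by (auto simp: primitive_root_of_unity_def)
  have z0: "z \<noteq> 0" using k by (auto simp: power_0_left)
  have False if "i \<ge> 1" "i < j" "j \<le> k" "z ^ i = z ^ j" for i j
  proof -
    have "z ^ i * z ^ (j - i) = z ^ j"
      using that(2) by (metis le_add_diff_inverse less_imp_le power_add)
    then have "z ^ (j - i) = 1" using that(4) z0 by simp
    then show False using min[of "j - i"] that by auto
  qed
  then show ?thesis
    by (intro linorder_inj_onI) auto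
qed

lemma roots_of_unity_eq_powers:
  assumes "primitive_root_of_unity k z"
  shows "{w. w ^ k = 1} = (\<lambda>j. z ^ j) ` {1..k}"
proof (rule sym, rule card_subset_eq)
  have k: "k > 0" "z ^ k = 1" using assms by (auto simp: primitive_root_of_unity_def)
  show "finite {w::complex. w ^ k = 1}" using k by (intro finite_roots_unity) simp
  have "(z ^ j) ^ k = 1" for j
    using k(2) by (metis mult.commute power_mult power_one)
  then show "(\<lambda>j. z ^ j) ` {1..k} \<subseteq> {w. w ^ k = 1}" by auto
  show "card ((\<lambda>j. z ^ j) ` {1..k}) = card {w::complex. w ^ k = 1}"
    using k card_image[OF primitive_root_power_inj[OF assms]] by (simp add: card_roots_unity_eq)
qed

lemma card_int_eval_roots:
  assumes "f \<noteq> 0"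
  shows "card {w. int_eval f w = 0} \<le> degree f"
proof -
  let ?F = "map_poly of_int f :: complex poly"
  have F: "?F \<noteq> 0" using assms by (simp add: map_poly_eq_0_iff)
  show "card {w. int_eval f w = 0} \<le> degree f"
    unfolding int_eval_def
    using card_poly_roots_bound[OF F] map_poly_degree_leq[of "of_int :: int \<Rightarrow> complex" f] by linarith
qed

text \<open>
A divisor of \<open>X\<^sup>k - 1\<close> inherits simple roots: the \<open>k\<close> distinct roots of \<open>f q\<close> are shared between \<open>f\<close> and
\<open>q\<close>, whose degrees add up to \<open>k\<close>, so neither can have fewer roots than its degree.
\<close>

lemma card_roots_factor_of_unity_polynomial:
  assumes k: "k > 0" and dvd: "f dvd monom 1 k - 1"
  shows "card {w. int_eval f w = 0} = degree f"
proof -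
  obtain q where q: "monom 1 k - 1 = f * q" using dvd by blast
  have "degree (monom 1 k - 1 :: int poly) = k" by (rule degree_monom_minus_1[OF k])
  then have "f * q \<noteq> 0" using q k by (metis degree_0 less_irrefl)
  then have nz: "f \<noteq> 0" "q \<noteq> 0" by auto
  have deg: "degree f + degree q = k"
    using degree_monom_minus_1[OF k] unfolding q by (simp add: degree_mult_eq nz)
  have "w ^ k = 1 \<longleftrightarrow> int_eval f w = 0 \<or> int_eval q w = 0" for w
  proof -
    have "w ^ k - 1 = int_eval (f * q) w" unfolding q[symmetric] by simp
    then show ?thesis by auto
  qed
  then have "{w. w ^ k = 1} = {w. int_eval f w = 0} \<union> {w. int_eval q w = 0}" by auto
  then have "k \<le> card {w. int_eval f w = 0} + card {w. int_eval q w = 0}"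
    using card_roots_unity_eq[OF k] by (metis card_Un_le)
  then show ?thesis
    using card_int_eval_roots[OF nz(1)] card_int_eval_roots[OF nz(2)] deg by linarith
qed

text \<open>
The minimal polynomial \<open>f\<close> of \<open>z\<close> is irreducible, hence is also the minimal polynomial of each of its
roots \<open>w\<close>. Concretely, the minimal polynomial \<open>h\<close> of \<open>w\<close> divides \<open>f\<close>; the cofactor has smaller degree
than \<open>f\<close> and cannot vanish at \<open>z\<close>, so \<open>h\<close> does.
\<close>

lemma relation_transfers_along_minimal_polynomial:
  fixes z w :: complex
  assumes min: "\<And>g. int_eval g z = 0 \<longleftrightarrow> f dvd g"
    and k: "k > 0" "w ^ k = 1" and f0: "f \<noteq> 0" and fw: "int_eval f w = 0" and gw: "int_eval g w = 0"
  shows "int_eval g z = 0"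
proof -
  obtain h where h: "lead_coeff h = 1" "\<And>g. int_eval g w = 0 \<longleftrightarrow> h dvd g"
    using minimal_int_polynomial[OF k] by blast
  obtain q where q: "f = h * q" using fw h(2) by blast
  have nz: "h \<noteq> 0" "q \<noteq> 0" using f0 q by auto
  have "int_eval q z \<noteq> 0"
  proof
    assume "int_eval q z = 0"
    then have "f dvd q" by (simp add: min)
    then have "degree f \<le> degree q" using nz by (intro dvd_imp_degree_le)
    then have "degree h = 0" using nz by (simp add: q degree_mult_eq)
    then have "h = 1" using h(1) by (auto elim!: degree_eq_zeroE simp: one_pCons)
    then show False using h(2)[of h] by simp
  qed
  moreover have "int_eval (h * q) z = 0" using min[of f] by (simp add: q)
  ultimately have "int_eval h z = 0" by simp
  moreover obtain u where "g = h * u" using gw h(2) by blast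
  ultimately show ?thesis by simp
qed

text \<open>
The roots of the minimal polynomial are exactly the primitive \<open>k\<close>-th roots of unity. They are all
roots by Landau's argument, and an imprimitive root would satisfy \<open>w\<^sup>l = 1\<close> for some \<open>l < k\<close>, a relation
that would transfer to \<open>z\<close>. As the roots are simple, counting them gives the degree.
\<close>

lemma degree_minimal_polynomial:
  assumes prim: "primitive_root_of_unity k z"
    and lead: "lead_coeff f = 1" and min: "\<And>g. int_eval g z = 0 \<longleftrightarrow> f dvd g"
  shows "degree f = totient k"
proof -
  have k: "k > 0" "z ^ k = 1" and least: "\<And>j. 0 < j \<Longrightarrow> j < k \<Longrightarrow> z ^ j \<noteq> 1"
    using prim by (auto simp: primitive_root_of_unity_def)
  have f0: "f \<noteq> 0" using lead by auto
  have dvd: "f dvd monom 1 k - 1" using k by (simp flip: min)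
  have "{w. int_eval f w = 0} = (\<lambda>j. z ^ j) ` totatives k"
  proof (intro equalityI subsetI)
    fix w assume "w \<in> {w. int_eval f w = 0}"
    then have fw: "int_eval f w = 0" by simp
    obtain q where "monom 1 k - 1 = f * q" using dvd by blast
    then have "int_eval (monom 1 k - 1) w = 0" using fw by simp
    then have wk: "w ^ k = 1" by simp
    then obtain j where j: "j \<in> {1..k}" "w = z ^ j"
      using roots_of_unity_eq_powers[OF prim] by blast
    define c where "c = gcd j k"
    obtain i l where i: "j = c * i" and l: "k = c * l"
      unfolding c_def by (meson dvdE gcd_dvd1 gcd_dvd2)
    have "w ^ l = (z ^ k) ^ i" unfolding j(2) i l by (simp add: ac_simps flip: power_mult)
    then have "int_eval (monom 1 l - 1) w = 0" by (simp add: k)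
    then have "int_eval (monom 1 l - 1) z = 0"
      by (rule relation_transfers_along_minimal_polynomial[OF min k(1) wk f0 fw])
    then have "z ^ l = 1" by simp
    then have "l = k" using least[of l] l k(1) by (cases "l < k") (auto simp: not_less)
    then have "c = 1" using l k(1) by simp
    then have "coprime j k" by (simp only: c_def coprime_iff_gcd_eq_1)
    then have "j \<in> totatives k" using j(1) by (simp add: totatives_def)
    then show "w \<in> (\<lambda>j. z ^ j) ` totatives k" using j(2) by blast
  next
    fix w assume "w \<in> (\<lambda>j. z ^ j) ` totatives k"
    then obtain j where "coprime j k" "w = z ^ j" by (auto simp: totatives_def)
    then show "w \<in> {w. int_eval f w = 0}"
      using coprime_power_preserves_zeros[OF k, of j f] min[of f] by simp
  qed
  moreover have "inj_on (\<lambda>j. z ^ j) (totatives k)"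
    by (rule inj_on_subset[OF primitive_root_power_inj[OF prim]]) (auto simp: totatives_def)
  ultimately have "card {w. int_eval f w = 0} = totient k"
    by (simp add: card_image totient_def)
  then show ?thesis
    using card_roots_factor_of_unity_polynomial[OF k(1) dvd] by simp
qed

text \<open>
Since the minimal polynomial is monic of degree \<open>totient k\<close>, division by it expresses each root of unity
through the first \<open>totient k\<close> powers of \<open>z\<close>, and no non-trivial relation between these powers exists.
\<close>

lemma bij_betw_cyclo_exponents:
  assumes prim: "primitive_root_of_unity k z"
  shows "bij_betw (\<lambda>a. \<Sum>i=1..totient k. of_int (a i) * z ^ (i - 1)) (cyclo_exponents k z) {w. w ^ k = 1}"
    (is "bij_betw ?val _ _")
proof -
  let ?d = "totient k"
  have k: "k > 0" "z ^ k = 1" using prim by (auto simp: primitive_root_of_unity_def)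
  obtain f where f: "lead_coeff f = 1" "\<And>g. int_eval g z = 0 \<longleftrightarrow> f dvd g"
    using minimal_int_polynomial[OF k] by blast
  have deg: "degree f = ?d" by (rule degree_minimal_polynomial[OF prim f])
  have val: "?val a = (\<Sum>n<?d. of_int (a (Suc n)) * z ^ n)" for a
    by (simp add: sum.atLeast1_atMost_eq)
  have "inj_on ?val (cyclo_exponents k z)"
  proof (rule inj_onI)
    fix a b assume a: "a \<in> cyclo_exponents k z" and b: "b \<in> cyclo_exponents k z" and eq: "?val a = ?val b"
    define g where "g = (\<Sum>n<?d. monom (a (Suc n) - b (Suc n)) n)"
    have coeff: "coeff g n = (if n < ?d then a (Suc n) - b (Suc n) else 0)" for n
      by (simp add: g_def coeff_sum)
    have "int_eval g z = ?val a - ?val b"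
      unfolding val by (simp add: g_def sum_subtractf algebra_simps)
    then have "f dvd g" using eq by (simp only: f(2)[symmetric]) simp
    moreover have "\<not> degree f \<le> degree g" if "g \<noteq> 0"
    proof -
      have "coeff g (degree g) \<noteq> 0" using that by simp
      then show ?thesis using deg by (simp add: coeff split: if_splits)
    qed
    ultimately have "g = 0" using dvd_imp_degree_le by blast
    then have ab: "a (Suc n) = b (Suc n)" if "n < ?d" for n
      using coeff[of n] that by simp
    show "a = b"
    proof (rule PiE_ext)
      show "a \<in> {1..?d} \<rightarrow>\<^sub>E UNIV" "b \<in> {1..?d} \<rightarrow>\<^sub>E UNIV"
        using a b by (auto simp: cyclo_exponents_def)
      show "a i = b i" if "i \<in> {1..?d}" for i
        using ab[of "i - 1"] that by (cases i) auto
    qed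
  qed
  moreover have "w \<in> ?val ` cyclo_exponents k z" if w: "w ^ k = 1" for w
  proof -
    obtain j where j: "w = z ^ j" using roots_of_unity_eq_powers[OF prim] w by blast
    obtain q r where r: "monom 1 j = f * q + r" "r = 0 \<or> degree r < degree f"
      using monic_division[OF f(1)] by blast
    define a where "a = restrict (\<lambda>i. coeff r (i - 1)) {1..?d}"
    obtain e where e: "?d = Suc e"
      using k(1) by (metis gr0_conv_Suc totient_gt_0_iff)
    have "?val a = (\<Sum>n<?d. of_int (coeff r n) * z ^ n)"
      unfolding val by (rule sum.cong) (auto simp: a_def)
    also have "\<dots> = int_eval r z"
      unfolding e lessThan_Suc_atMost
      using r(2) deg e by (intro int_eval_altdef[symmetric]) auto
    also have "\<dots> = int_eval (monom 1 j) z"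
      using f(2)[of f] unfolding r(1) by simp
    finally have "?val a = w" by (simp add: j)
    moreover have "a \<in> cyclo_exponents k z"
      unfolding cyclo_exponents_def using \<open>?val a = w\<close> w by (auto simp: a_def)
    ultimately show ?thesis by blast
  qed
  ultimately show ?thesis
    unfolding bij_betw_def by (auto simp: cyclo_exponents_def)
qed

section \<open>Points of the torus given by characters\<close>

lemma prod_cis_powi:
  "(\<Prod>i\<in>I. cis (\<theta> i) powi a i) = cis (\<Sum>i\<in>I. of_int (a i) * \<theta> i)"
proof (induction I rule: infinite_finite_induct)
  case (insert i I)
  then show ?case by (simp add: cis_power_int cis_mult)
qed simp_all

text \<open>
A real-linear form \<open>\<phi>\<close> yields the character \<open>cis \<circ> \<phi>\<close> of the additive group \<open>\<int>[z]\<close>. If the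
coordinates are the values of this character on the power basis, each monomial is its value at the
root of unity that the exponent vector encodes. The coordinate of index 0 does not occur in the
polynomial; it is left as a parameter so that the equation of the cyclovariety can be solved for it.
\<close>

lemma cyclo_poly_at_character:
  fixes \<phi> :: "complex \<Rightarrow> real"
  assumes prim: "primitive_root_of_unity k z" and lin: "linear \<phi>"
  shows "cyclo_poly k z (restrict (\<lambda>i. if i = 0 then c else cis (\<phi> (z ^ (i - 1)))) {0..totient k})
       = (\<Sum>w | w ^ k = 1. cis (\<phi> w))"
proof -
  let ?val = "\<lambda>a. \<Sum>i=1..totient k. of_int (a i) * z ^ (i - 1)"
  let ?x = "restrict (\<lambda>i. if i = 0 then c else cis (\<phi> (z ^ (i - 1)))) {0..totient k}"
  have "(\<Prod>i=1..totient k. ?x i powi a i) = cis (\<phi> (?val a))" for a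
  proof -
    have "(\<Prod>i=1..totient k. ?x i powi a i) = (\<Prod>i=1..totient k. cis (\<phi> (z ^ (i - 1))) powi a i)"
      by (rule prod.cong) auto
    also have "\<dots> = cis (\<Sum>i=1..totient k. of_int (a i) * \<phi> (z ^ (i - 1)))"
      by (rule prod_cis_powi)
    also have "(\<Sum>i=1..totient k. of_int (a i) * \<phi> (z ^ (i - 1))) = \<phi> (?val a)"
    proof -
      have "\<phi> (of_int m * w) = of_int m * \<phi> w" for m w
        using linear_scale[OF lin, of "of_int m" w] by (simp add: scaleR_conv_of_real)
      then show ?thesis by (simp add: linear_sum[OF lin])
    qed
    finally show ?thesis .
  qed
  then have "cyclo_poly k z ?x = (\<Sum>a\<in>cyclo_exponents k z. cis (\<phi> (?val a)))"
    by (simp only: cyclo_poly_def)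
  also have "\<dots> = (\<Sum>w | w ^ k = 1. cis (\<phi> w))"
    by (rule sum.reindex_bij_betw[OF bij_betw_cyclo_exponents[OF prim]])
  finally show ?thesis .
qed

lemma cyclovariety_meets_unit_torus_if_character_sum:
  fixes \<phi> :: "complex \<Rightarrow> real"
  assumes prim: "primitive_root_of_unity k z" and lin: "linear \<phi>"
    and sum: "norm (\<Sum>w | w ^ k = 1. cis (\<phi> w)) = 1"
  shows "cyclovariety k z \<inter> unit_torus (totient k) \<noteq> {}"
proof -
  define S where "S = (\<Sum>w | w ^ k = 1. cis (\<phi> w))"
  define x where "x = restrict (\<lambda>i. if i = 0 then - S else cis (\<phi> (z ^ (i - 1)))) {0..totient k}"
  have S: "norm S = 1" using sum by (simp add: S_def)
  then have "S \<noteq> 0" by auto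
  then have "x \<in> cyclovariety k z"
    using cyclo_poly_at_character[OF prim lin, of "- S"]
    by (auto simp: cyclovariety_def x_def S_def)
  moreover have "x \<in> unit_torus (totient k)"
    using S by (auto simp: unit_torus_def x_def)
  ultimately show ?thesis by blast
qed

section \<open>A character sum of modulus one\<close>

text \<open>
The sum has mean value zero. An elementary form of this: if it were positive everywhere, its second
antiderivative \<open>H\<close> would be strictly convex and would grow at least linearly, whereas as a combination
of cosines it is bounded.
\<close>

lemma sum_cos_nonpos_somewhere:
  fixes \<nu> :: "'a \<Rightarrow> real"
  assumes fin: "finite I" and nz: "\<And>i. i \<in> I \<Longrightarrow> \<nu> i \<noteq> 0"
  shows "\<exists>t. (\<Sum>i\<in>I. cos (\<nu> i * t)) \<le> 0"
proof (rule ccontr)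
  assume "\<nexists>t. (\<Sum>i\<in>I. cos (\<nu> i * t)) \<le> 0"
  then have pos: "(\<Sum>i\<in>I. cos (\<nu> i * t)) > 0" for t by (simp add: not_le)
  define G where "G t = (\<Sum>i\<in>I. sin (\<nu> i * t) / \<nu> i)" for t
  define H where "H t = (\<Sum>i\<in>I. - cos (\<nu> i * t) / (\<nu> i)\<^sup>2)" for t
  define M where "M = (\<Sum>i\<in>I. 1 / (\<nu> i)\<^sup>2)"
  have dG: "(G has_real_derivative (\<Sum>i\<in>I. cos (\<nu> i * t))) (at t)" for t
    unfolding G_def using nz by (auto intro!: derivative_eq_intros DERIV_sum)
  have dH: "(H has_real_derivative G t) (at t)" for t
    unfolding H_def G_def using nz
    by (auto intro!: derivative_eq_intros DERIV_sum simp: power2_eq_square)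
  have mono: "G s < G t" if "s < t" for s t
  proof (rule DERIV_pos_imp_increasing[OF that])
    show "\<exists>y. (G has_real_derivative y) (at u) \<and> y > 0" for u
      using dG[of u] pos[of u] by blast
  qed
  have G0: "G 0 = 0" by (simp add: G_def)
  have growth: "H t - H 1 \<ge> (t - 1) * G 1" if t: "t > 1" for t
  proof -
    obtain u where u: "1 < u" "H t - H 1 = (t - 1) * G u"
      using MVT2[OF t, of H G] dH by blast
    then show ?thesis using mono[of 1 u] t by (simp add: mult_left_mono)
  qed
  have bounded: "\<bar>H t\<bar> \<le> M" for t
  proof -
    have "\<bar>H t\<bar> \<le> (\<Sum>i\<in>I. \<bar>- cos (\<nu> i * t) / (\<nu> i)\<^sup>2\<bar>)"
      unfolding H_def by (rule sum_abs)
    also have "\<dots> \<le> M"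
      unfolding M_def by (intro sum_mono) (simp add: divide_right_mono)
    finally show ?thesis .
  qed
  \<comment> \<open>Chosen so that the linear growth \<open>(t - 1) G 1\<close> exceeds the largest possible variation \<open>2 M\<close> of \<open>H\<close>.\<close>
  define t where "t = 2 + 2 * M / G 1"
  have G1: "G 1 > 0" using mono[of 0 1] G0 by simp
  have "M \<ge> 0" using bounded[of 0] by linarith
  then have "t > 1" using G1 by (simp add: t_def add_pos_nonneg)
  then have "(t - 1) * G 1 \<le> 2 * M"
    using growth[of t] bounded[of t] bounded[of 1] by linarith
  moreover have "(t - 1) * G 1 = G 1 + 2 * M" using G1 by (simp add: t_def field_simps)
  ultimately show False using G1 by simp
qed

text \<open>
The involution \<open>N\<close> makes the character sums of multiples of \<open>\<nu>\<close> real. For even \<open>k\<close> negation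
permutes the roots of unity, and any linear form vanishing at none of them serves. For odd \<open>k\<close>
complex conjugation takes its role: it negates the imaginary part, which vanishes at no root of
unity other than 1 because -1 is not one.
\<close>

lemma exists_linear_symmetric_frequencies:
  assumes k: "k > 0"
  obtains \<nu> :: "complex \<Rightarrow> real" and N where
    "linear \<nu>"
    "bij_betw N {w. w ^ k = 1} {w. w ^ k = 1}" "\<And>w. w ^ k = 1 \<Longrightarrow> \<nu> (N w) = - \<nu> w"
    "\<And>w. w ^ k = 1 \<Longrightarrow> w \<noteq> 1 \<Longrightarrow> \<nu> w \<noteq> 0"
proof (cases "even k")
  case True
  let ?R = "{w :: complex. w ^ k = 1}"
  have "finite ?R" using k by (intro finite_roots_unity) simp
  then have "finite ((\<lambda>w. - Re w / Im w) ` ?R)" by simp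
  then obtain s where s: "s \<notin> (\<lambda>w. - Re w / Im w) ` ?R"
    using ex_new_if_finite[OF infinite_UNIV_char_0] by blast
  show ?thesis
  proof (rule that[of "\<lambda>w. Re w + s * Im w" uminus])
    show "linear (\<lambda>w. Re w + s * Im w)"
      by (rule linearI) (simp_all add: algebra_simps)
    show "bij_betw uminus ?R ?R"
      by (rule bij_betwI[of _ _ _ uminus]) (use True in auto)
    show "Re w + s * Im w \<noteq> 0" if "w ^ k = 1" for w
    proof
      assume eq: "Re w + s * Im w = 0"
      have "w \<noteq> 0" using that k by (auto simp: power_0_left)
      then have "Im w \<noteq> 0" using eq by (auto simp: complex_eq_iff)
      then have "s = - Re w / Im w" using eq by (simp add: field_simps)
      then show False using s that by blast
    qed
  qed (simp add: algebra_simps)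
next
  case False
  let ?R = "{w :: complex. w ^ k = 1}"
  show ?thesis
  proof (rule that[of Im cnj])
    show "linear Im" by (rule linearI) simp_all
    show "bij_betw cnj ?R ?R"
      by (rule bij_betwI[of _ _ _ cnj]) (auto simp flip: complex_cnj_power)
    show "Im w \<noteq> 0" if w: "w ^ k = 1" "w \<noteq> 1" for w
    proof
      assume "Im w = 0"
      then have real: "w = of_real (Re w)" by (simp add: complex_eq_iff)
      have "Re w ^ k = 1"
        using w(1) real by (metis of_real_eq_1_iff of_real_power)
      then have "Re w = 1"
        using odd_real_root_power_cancel[OF False, of "Re w"] k by simp
      then show False using w(2) real by simp
    qed
  qed simp
qed

text \<open>
Along the multiples \<open>t \<nu>\<close> the character sum is a real continuous function of \<open>t\<close> with value \<open>k\<close> at 0.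
The frequencies at \<open>w \<noteq> 1\<close> are non-zero, so their cosines have a non-positive sum for some \<open>t\<close>; the
remaining term is at most 1. The intermediate value theorem gives the value 1.
\<close>

lemma character_sum_eq_1:
  assumes k: "k > 0"
  obtains \<phi> :: "complex \<Rightarrow> real" where "linear \<phi>" "(\<Sum>w | w ^ k = 1. cis (\<phi> w)) = 1"
proof -
  let ?R = "{w :: complex. w ^ k = 1}"
  obtain \<nu> :: "complex \<Rightarrow> real" and N where lin: "linear \<nu>"
    and N: "bij_betw N ?R ?R" "\<And>w. w ^ k = 1 \<Longrightarrow> \<nu> (N w) = - \<nu> w"
    and nz: "\<And>w. w ^ k = 1 \<Longrightarrow> w \<noteq> 1 \<Longrightarrow> \<nu> w \<noteq> 0"
    using exists_linear_symmetric_frequencies[OF k] by blast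
  have fin: "finite ?R" using k by (intro finite_roots_unity) simp
  define F where "F t = (\<Sum>w\<in>?R. cos (\<nu> w * t))" for t
  have sum: "(\<Sum>w\<in>?R. cis (\<nu> w * t)) = of_real (F t)" for t
  proof -
    have "(\<Sum>w\<in>?R. sin (\<nu> w * t)) = (\<Sum>w\<in>?R. sin (\<nu> (N w) * t))"
      by (rule sum.reindex_bij_betw[OF N(1), symmetric])
    also have "\<dots> = - (\<Sum>w\<in>?R. sin (\<nu> w * t))"
      by (simp add: N(2) sum_negf)
    finally have "(\<Sum>w\<in>?R. sin (\<nu> w * t)) = 0" by simp
    then show ?thesis by (simp add: complex_eq_iff F_def)
  qed
  have R1: "?R = insert 1 (?R - {1})" by auto
  obtain t where t: "(\<Sum>w\<in>?R - {1}. cos (\<nu> w * t)) \<le> 0"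
    using sum_cos_nonpos_somewhere[of "?R - {1}" \<nu>] fin nz by auto
  have "F t = cos (\<nu> 1 * t) + (\<Sum>w\<in>?R - {1}. cos (\<nu> w * t))"
    unfolding F_def by (subst R1, subst sum.insert) (use fin in auto)
  then have Ft: "F t \<le> 1" using t cos_le_one[of "\<nu> 1 * t"] by linarith
  have "F 0 = k" using card_roots_unity_eq[OF k] by (simp add: F_def)
  then have F0: "F 0 \<ge> 1" using k by simp
  have "continuous_on UNIV F"
    unfolding F_def by (intro continuous_intros)
  then have "connected (range F)" by (rule connected_continuous_image) simp
  then obtain u where u: "F u = 1"
    using connectedD_interval[of "range F" "F t" "F 0" 1] Ft F0 by fastforce
  show thesis
  proof (rule that)
    show "linear (\<lambda>w. \<nu> w * u)"
      by (rule linearI) (simp_all add: linear_add[OF lin] linear_scale[OF lin] algebra_simps)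
    show "(\<Sum>w\<in>?R. cis (\<nu> w * u)) = 1" using sum[of u] u by simp
  qed
qed

section \<open>The torus point\<close>

theorem proposition5p3p1:
  fixes k :: nat and \<zeta> :: complex
  assumes "primitive_root_of_unity k \<zeta>"
    and "(\<exists>n. k = 2 ^ n) \<or> (odd k \<and> k \<le> 2 * totient k)
         \<or> (\<exists>l. k = 2 * l \<and> odd l \<and> l \<le> 2 * totient l)"
  shows "cyclovariety k \<zeta> \<inter> unit_torus (totient k) \<noteq> {}"
proof -
  have "k > 0" using assms(1) by (simp add: primitive_root_of_unity_def)
  then obtain \<phi> :: "complex \<Rightarrow> real"
    where lin: "linear \<phi>" and sum: "(\<Sum>w | w ^ k = 1. cis (\<phi> w)) = 1"
    by (rule character_sum_eq_1)
  show ?thesis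
    by (rule cyclovariety_meets_unit_torus_if_character_sum[OF assms(1) lin])
       (unfold sum, rule norm_one)
qed

end
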